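(* Let $f\in\mathcal F_{\pi/2}$ be even around $\frac{\pi}{2}$, let $\varepsilon>0$, and let $\phi^*$ be an equilibrium of the system on the complete graph with $N$ vertices, $$\dot\phi_i=\varepsilon\sum_{j\neq i} f(\phi_j-\phi_i),\qquad i=1,\dots,N,$$ with isotropy $(S_{k_1}\times S_{k_2}\times\cdots\times S_{k_{l_B}})^m\rtimes Z_m$. If $m$ is even, then $\phi^*$ is unstable.
   Context: Phases $\phi_i$ take values in the unit circle $\mathbb{S}^1=\mathbb{R}/2\pi\mathbb{Z}$; the state space is the $N$-torus $\mathcal T^N$. $f\in\mathcal F_{\pi/2}$ means that $f:\mathbb{R}\to\mathbb{R}$ is $2\pi$-periodic, odd, continuously differentiable, with $f'(\theta)>0$ for $\theta\in(0,\frac{\pi}{2})\cup(\frac{3\pi}{2},2\pi)$ and $f'(\theta)<0$ for $\theta\in(\frac{\pi}{2},\frac{3\pi}{2})$. "Even around $\frac{\pi}{2}$" means $f(\frac{\pi}{2}+\theta)=f(\frac{\pi}{2}-\theta)$ for all $\theta$. The system is equivariant under $S_N\times T^1$, where $S_N$ permutes the $N$ coordinates and $\delta\in T^1=[0,2\pi)$ acts by $\phi_i\mapsto\phi_i+\delta$ for all $i$. The isotropy subgroup of $\phi^*$ is $\{\gamma\in S_N\times T^1:\gamma\phi^*=\phi^*\}$. It has the form $(S_{k_1}\times\cdots\times S_{k_{l_B}})^m\rtimes Z_m$, where $k_1,\dots,k_{l_B},m$ are positive integers with $(k_1+\cdots+k_{l_B})m=N$, $S_{k}$ is a permutation group of $k$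 coordinates, and $Z_m$ is the cyclic group with action $\phi_i\mapsto\phi_i+\frac{2\pi}{m}$ (combined with a permutation of the coordinates). In other words, an equilibrium with this isotropy consists of $l_B$ phase-shifted constellations, the $l$-th one made of $m$ blocks evenly distributed on the circle with $k_l$ oscillators per block: there are an angle $\alpha$ and shifts $\delta_1,\dots,\delta_{l_B}$, distinct modulo $\frac{2\pi}{m}$, such that for every $l\in\{1,\dots,l_B\}$ and $r\in\{0,\dots,m-1\}$ exactly $k_l$ oscillators have phase $\alpha+\delta_l+\frac{2\pi r}{m}$. *)

theory Defs
  imports "HOL-Analysis.Analysis" "HOL-Library.Real_Mod"
begin

text \<open>
  A point of the torus \<open>(\<real>/2\<pi>\<int>)\<^sup>N\<close> is represented by a lift to \<^typ>\<open>real ^ 'n\<close>, with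
  \<open>N = CARD('n)\<close>. Lifts of the same point are congruent coordinatewise modulo \<open>2\<pi>\<close>.
\<close>

definition torus_eq :: "real ^ 'n \<Rightarrow> real ^ 'n \<Rightarrow> bool" where
  "torus_eq \<phi> \<psi> \<longleftrightarrow> (\<forall>i. [\<phi> $ i = \<psi> $ i] (rmod (2 * pi)))"

text \<open>The quotient metric on \<open>\<real>/2\<pi>\<int>\<close>.\<close>

definition circle_dist :: "real \<Rightarrow> real \<Rightarrow> real" where
  "circle_dist a b = (INF k::int. \<bar>a - b + 2 * pi * of_int k\<bar>)"

definition F_half_pi :: "(real \<Rightarrow> real) set" where
  "F_half_pi = {f.
     (\<forall>\<theta>. f (\<theta> + 2 * pi) = f \<theta>) \<and>
     (\<forall>\<theta>. f (- \<theta>) = - f \<theta>) \<and>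
     f C1_differentiable_on UNIV \<and>
     (\<forall>\<theta> \<in> {0<..<pi / 2} \<union> {3 * pi / 2<..<2 * pi}. deriv f \<theta> > 0) \<and>
     (\<forall>\<theta> \<in> {pi / 2<..<3 * pi / 2}. deriv f \<theta> < 0)}"

definition even_around_half_pi :: "(real \<Rightarrow> real) \<Rightarrow> bool" where
  "even_around_half_pi f \<longleftrightarrow> (\<forall>\<theta>. f (pi / 2 + \<theta>) = f (pi / 2 - \<theta>))"

definition complete_graph_field ::
    "(real \<Rightarrow> real) \<Rightarrow> real \<Rightarrow> real ^ 'n::finite \<Rightarrow> real ^ 'n" where
  "complete_graph_field f \<epsilon> \<phi> = (\<chi> i. \<epsilon> * (\<Sum>j \<in> UNIV - {i}. f (\<phi> $ j - \<phi> $ i)))"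

definition equilibrium :: "(real ^ 'n \<Rightarrow> real ^ 'n) \<Rightarrow> real ^ 'n \<Rightarrow> bool" where
  "equilibrium F \<phi> \<longleftrightarrow> F \<phi> = 0"

text \<open>
  Trajectories on the torus are described by their continuous lifts. Since the torus is compact,
  solutions of the systems considered here exist for all forward time, so only solutions on
  \<open>[0, \<infinity>)\<close> matter.
\<close>

definition forward_solution ::
    "(real ^ 'n::finite \<Rightarrow> real ^ 'n) \<Rightarrow> (real \<Rightarrow> real ^ 'n) \<Rightarrow> bool" where
  "forward_solution F x \<longleftrightarrow> (\<forall>t \<ge> 0. (x has_vector_derivative F (x t)) (at t within {0..}))"

text \<open>Lyapunov stability with respect to the metric of the torus.\<close>

definition torus_stable :: "(real ^ 'n::finite \<Rightarrow> real ^ 'n) \<Rightarrow> real ^ 'n \<Rightarrow> bool" where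
  "torus_stable F \<phi> \<longleftrightarrow>
     (\<forall>e > 0. \<exists>d > 0. \<forall>x.
        forward_solution F x \<and> (\<forall>i. circle_dist (x 0 $ i) (\<phi> $ i) < d) \<longrightarrow>
        (\<forall>t \<ge> 0. \<forall>i. circle_dist (x t $ i) (\<phi> $ i) < e))"

definition torus_unstable :: "(real ^ 'n::finite \<Rightarrow> real ^ 'n) \<Rightarrow> real ^ 'n \<Rightarrow> bool" where
  "torus_unstable F \<phi> \<longleftrightarrow> \<not> torus_stable F \<phi>"

text \<open>
  The group \<open>S\<^sub>N \<times> T\<^sup>1\<close>, with \<open>T\<^sup>1 = [0, 2\<pi>)\<close>. It acts on the left, so a permutation
  \<open>\<sigma>\<close> moves the phase of oscillator \<open>i\<close> to oscillator \<open>\<sigma> i\<close>.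
\<close>

definition symmetries :: "(('n \<Rightarrow> 'n) \<times> real) set" where
  "symmetries = {\<sigma>. \<sigma> permutes UNIV} \<times> {0..<2 * pi}"

definition symmetry_act :: "('n \<Rightarrow> 'n) \<times> real \<Rightarrow> real ^ 'n \<Rightarrow> real ^ 'n" where
  "symmetry_act \<gamma> \<phi> = (\<chi> i. \<phi> $ (inv (fst \<gamma>) i) + snd \<gamma>)"

definition isotropy :: "real ^ 'n \<Rightarrow> (('n \<Rightarrow> 'n) \<times> real) set" where
  "isotropy \<phi> = {\<gamma> \<in> symmetries. torus_eq (symmetry_act \<gamma> \<phi>) \<phi>}"

text \<open>
  The subgroups \<open>(S\<^bsub>k\<^sub>1\<^esub> \<times> \<dots> \<times> S\<^bsub>k\<^sub>l\<^esub>)\<^sup>m \<rtimes> Z\<^sub>m\<close> of \<open>S\<^sub>N \<times> T\<^sup>1\<close>,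
  where \<open>ks = [k\<^sub>1, \<dots>, k\<^sub>l]\<close>, one for every arrangement of the oscillators in blocks:
  \<open>B i = (l, r)\<close> says that oscillator \<open>i\<close> lies in block \<open>r\<close> of constellation \<open>l\<close> (both counted
  from 0). The normal factor consists of the permutations preserving every block. The factor
  \<open>Z\<^sub>m\<close> is generated by \<open>(\<tau>, 2\<pi>/m)\<close>, where \<open>\<tau>\<close> has \<open>\<tau>\<^sup>m = id\<close> and moves each block to the next
  one of its constellation. The subgroup is the product of the two factors, which meet trivially.
\<close>

definition block_cyclic_group ::
    "('n \<Rightarrow> nat \<times> nat) \<Rightarrow> ('n \<Rightarrow> 'n) \<Rightarrow> nat \<Rightarrow> (('n \<Rightarrow> 'n) \<times> real) set" where
  "block_cyclic_group B \<tau> m =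
     {((\<tau> ^^ r) \<circ> \<sigma>, 2 * pi * real r / real m) | r \<sigma>.
        r < m \<and> \<sigma> permutes UNIV \<and> (\<forall>i. B (\<sigma> i) = B i)}"

definition block_cyclic_subgroups :: "nat list \<Rightarrow> nat \<Rightarrow> (('n \<Rightarrow> 'n) \<times> real) set set" where
  "block_cyclic_subgroups ks m =
     {block_cyclic_group B \<tau> m | B \<tau>.
        (\<forall>i. B i \<in> {..<length ks} \<times> {..<m}) \<and>
        (\<forall>l < length ks. \<forall>r < m. card {i. B i = (l, r)} = ks ! l) \<and>
        \<tau> permutes UNIV \<and> \<tau> ^^ m = id \<and>
        (\<forall>i. B (\<tau> i) = (fst (B i), (snd (B i) + 1) mod m))}"

end

theory Submission
  imports Defs
begin

text \<open>
  For even \<open>m\<close> the isotropy contains the half turn, so the oscillators come in antipodal pairs.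
  Oddness and evenness around \<open>\<pi>/2\<close> give \<open>f' (\<theta> + \<pi>) = - f' \<theta>\<close>, so the terms of
  \<open>\<Sum>\<^sub>j f' (\<phi>\<^sub>j - \<phi>\<^sub>i)\<close> cancel in pairs and the Jacobian is the symmetric matrix
  \<open>\<epsilon> f' (\<phi>\<^sub>j - \<phi>\<^sub>i)\<close>. Its diagonal entries are \<open>\<epsilon> f' 0 = - \<epsilon> f' \<pi> > 0\<close>, so it has a positive
  eigenvalue. A Chetaev function turns this into nonlinear instability; solutions starting near
  \<open>\<phi>\<close> exist for all time because the vector field is bounded and Lipschitz.
\<close>

section \<open>Global solutions of Lipschitz differential equations\<close>

text \<open>Near \<open>t\<close> the half line coincides with \<open>{0..t+1}\<close>, so the
  fundamental theorem on a compact interval suffices, including the one-sided derivative at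
  \<open>0\<close>.\<close>

lemma indefinite_integral_atLeast:
  fixes h :: "real \<Rightarrow> 'a::banach"
  assumes "continuous_on {0..} h"
  shows "t \<ge> 0 \<Longrightarrow> ((\<lambda>u. integral {0..u} h) has_vector_derivative h t) (at t within {0..})"
    and "continuous_on {0..} (\<lambda>u. integral {0..u} h)"
proof -
  show *: "((\<lambda>u. integral {0..u} h) has_vector_derivative h t) (at t within {0..})" if "t \<ge> 0" for t
  proof -
    have "((\<lambda>u. integral {0..u} h) has_vector_derivative h t) (at t within {0..t+1})"
      by (rule integral_has_vector_derivative) (use that assms in \<open>auto intro: continuous_on_subset\<close>)
    moreover have "at t within {0..t+1} = at t within {0..}"
      by (rule at_within_nhd[where S = "{..<t+1}"]) auto
    ultimately show ?thesis by simp
  qed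
  show "continuous_on {0..} (\<lambda>u. integral {0..u} h)"
    using * has_vector_derivative_continuous by (fastforce simp: continuous_on_eq_continuous_within)
qed

text \<open>
  Picard's operator, conjugated with the weight \<open>exp (- K t)\<close>, is a contraction of the bounded
  continuous functions once \<open>K\<close> exceeds the Lipschitz constant. Functions on \<open>[0, \<infinity>)\<close> are
  extended to the line by their value at \<open>0\<close>.
\<close>

lemma bounded_lipschitz_global_solution:
  fixes F :: "'a::banach \<Rightarrow> 'a"
  assumes lip: "L-lipschitz_on UNIV F" and bd: "\<And>x. norm (F x) \<le> M"
  obtains x where "x 0 = x0"
    and "\<And>t. t \<ge> 0 \<Longrightarrow> (x has_vector_derivative F (x t)) (at t within {0..})"
proof -
  have L: "L \<ge> 0" and lipF: "norm (F x - F y) \<le> L * norm (x - y)" for x y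
    using lip by (auto simp: lipschitz_on_def dist_norm)
  have M: "M \<ge> 0" using order_trans[OF norm_ge_zero bd] by blast
  \<comment> \<open>Picard's operator will contract with factor \<open>L / K\<close>; this choice
    makes it at most \<open>1/2\<close> and keeps \<open>K\<close> positive even for
    \<open>L = 0\<close>.\<close>
  define K where "K = 2 * L + 1"
  have K: "K > 0" "L / K \<le> 1/2" using L by (auto simp: K_def field_simps)
  \<comment> \<open>The unknown \<open>y\<close> is the solution times the weight; the factor
    \<open>exp (K * s)\<close> restores the solution before \<open>F\<close> is applied.\<close>
  define h where "h y s = F (exp (K * s) *\<^sub>R apply_bcontfun y s)" for y :: "real \<Rightarrow>\<^sub>C 'a" and s
  define P where "P y t = exp (- (K * max t 0)) *\<^sub>R (x0 + integral {0..max t 0} (h y))" for y t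
  have contF: "continuous_on UNIV F"
    using lip by (rule lipschitz_on_continuous_on)
  have conth: "continuous_on S (h y)" for S y
    unfolding h_def
    by (rule continuous_on_compose2[OF contF]) (auto intro!: continuous_intros)
  have inth: "h y integrable_on {0..t}" for y t
    by (rule integrable_continuous_real[OF conth])
  have expint: "((\<lambda>s. exp (K * s)) has_integral (exp (K * t) / K - 1 / K)) {0..t}" if "t \<ge> 0" for t
  proof -
    have "((\<lambda>s. exp (K * s)) has_integral (exp (K * t) / K - exp (K * 0) / K)) {0..t}"
      by (rule fundamental_theorem_of_calculus[OF that])
         (use K in \<open>auto intro!: derivative_eq_intros simp: has_real_derivative_iff_has_vector_derivative[symmetric]\<close>)
    thus ?thesis by simp
  qed
  have PB: "P y \<in> bcontfun" for y
  proof -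
    have "continuous_on UNIV (P y)"
    proof -
      have "continuous_on UNIV (\<lambda>t::real. integral {0..max t 0} (h y))"
        by (rule continuous_on_compose2[OF indefinite_integral_atLeast(2)[OF conth]])
           (auto intro!: continuous_intros)
      thus ?thesis unfolding P_def by (intro continuous_intros)
    qed
    \<comment> \<open>Since \<open>F\<close> is bounded, the integral grows at most linearly, and
      the weight absorbs this growth because \<open>u * exp (- u)\<close> is at most 1.\<close>
    moreover have "norm (P y t) \<le> norm x0 + M / K" for t
    proof -
      define u where "u = max t 0"
      have u: "u \<ge> 0" by (simp add: u_def)
      have "norm (integral {0..u} (h y)) \<le> M * (u - 0)"
        by (rule integral_bound[OF u conth]) (simp add: h_def bd)
      hence "norm (x0 + integral {0..u} (h y)) \<le> norm x0 + M * u"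
        using norm_triangle_ineq[of x0 "integral {0..u} (h y)"] by simp
      hence "norm (P y t) \<le> exp (- (K * u)) * (norm x0 + M * u)"
        unfolding P_def u_def[symmetric] by (simp add: mult_left_mono)
      also have "\<dots> = exp (- (K * u)) * norm x0 + M / K * (exp (- (K * u)) * (K * u))"
        using K by (simp add: field_simps)
      also have "\<dots> \<le> 1 * norm x0 + M / K * 1"
      proof (intro add_mono mult_right_mono mult_left_mono)
        have "K * u \<le> exp (K * u)" using exp_ge_add_one_self[of "K * u"] by linarith
        thus "exp (- (K * u)) * (K * u) \<le> 1" by (simp add: exp_minus field_simps)
      qed (use K u M in auto)
      finally show ?thesis by simp
    qed
    hence "bounded (range (P y))" by (auto simp: bounded_iff)
    ultimately show ?thesis by (simp add: bcontfun_def)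
  qed
  define T where "T y = Bcontfun (P y)" for y
  have T: "apply_bcontfun (T y) = P y" for y
    by (simp add: T_def Bcontfun_inverse PB)
  have contr: "dist (T y) (T z) \<le> 1/2 * dist y z" for y z
  proof (rule dist_bound)
    fix t :: real
    define u where "u = max t 0"
    have u: "u \<ge> 0" by (simp add: u_def)
    have "P y t - P z t = exp (- (K * u)) *\<^sub>R (integral {0..u} (h y) - integral {0..u} (h z))"
      by (simp add: P_def u_def algebra_simps)
    also have "integral {0..u} (h y) - integral {0..u} (h z) = integral {0..u} (\<lambda>s. h y s - h z s)"
      by (simp add: integral_diff inth)
    finally have eq: "P y t - P z t = exp (- (K * u)) *\<^sub>R integral {0..u} (\<lambda>s. h y s - h z s)" .
    have int1: "((\<lambda>s. L * dist y z * exp (K * s)) has_integral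
        L * dist y z * (exp (K * u) / K - 1 / K)) {0..u}"
      by (rule has_integral_mult_right[OF expint[OF u]])
    have "norm (integral {0..u} (\<lambda>s. h y s - h z s)) \<le> integral {0..u} (\<lambda>s. L * dist y z * exp (K * s))"
    proof (rule integral_norm_bound_integral)
      fix s
      have "norm (h y s - h z s) \<le> L * norm (exp (K * s) *\<^sub>R y s - exp (K * s) *\<^sub>R z s)"
        unfolding h_def by (rule lipF)
      also have "\<dots> = L * (exp (K * s) * dist (y s) (z s))"
        by (simp add: dist_norm flip: scaleR_diff_right)
      also have "\<dots> \<le> L * (exp (K * s) * dist y z)"
        by (intro mult_left_mono dist_bounded L) auto
      finally show "norm (h y s - h z s) \<le> L * dist y z * exp (K * s)" by (simp add: mult_ac)
    qed (use int1 inth in \<open>auto intro!: integrable_diff\<close>)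
    also have "\<dots> = L * dist y z * (exp (K * u) / K - 1 / K)"
      using int1 by (rule integral_unique)
    also have "\<dots> \<le> L * dist y z * (exp (K * u) / K)"
      using K L by (intro mult_left_mono) auto
    finally have "exp (- (K * u)) * norm (integral {0..u} (\<lambda>s. h y s - h z s))
        \<le> exp (- (K * u)) * (L * dist y z * (exp (K * u) / K))"
      by (intro mult_left_mono) auto
    also have "\<dots> = (L / K) * dist y z" by (simp add: exp_minus)
    also have "\<dots> \<le> 1/2 * dist y z" using K by (intro mult_right_mono) auto
    finally show "dist (T y t) (T z t) \<le> 1/2 * dist y z"
      by (simp add: T dist_norm eq)
  qed
  obtain y where y: "T y = y"
    using banach_fix_type[of "1/2" T] contr by auto
  \<comment> \<open>Removing the weight from the fixed point turns \<open>T y = y\<close> into the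
    integral equation.\<close>
  define x where "x t = exp (K * t) *\<^sub>R apply_bcontfun y t" for t
  have x: "x t = x0 + integral {0..t} (h y)" if "t \<ge> 0" for t
    using T[of y] that unfolding x_def y
    by (simp add: P_def flip: exp_add)
  show thesis
  proof
    show "x 0 = x0" by (simp add: x)
    fix t :: real assume t: "t \<ge> 0"
    have "((\<lambda>t. x0 + integral {0..t} (h y)) has_vector_derivative F (x t)) (at t within {0..})"
      using indefinite_integral_atLeast(1)[OF conth t]
      by (auto intro!: derivative_eq_intros simp: h_def x_def)
    thus "(x has_vector_derivative F (x t)) (at t within {0..})"
      by (rule has_vector_derivative_transform[rotated 2]) (use t x in auto)
  qed
qed

section \<open>Instability from a positive direction of a self-adjoint linearization\<close>

text \<open>Eigenvectors for distinct eigenvalues are orthogonal, hence independent, and an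
  independent set in a Euclidean space is finite. This leaves room to choose a shift that is not an
  eigenvalue.\<close>

lemma self_adjoint_finite_eigenvalues:
  fixes A :: "'a::euclidean_space \<Rightarrow> 'a"
  assumes sa: "\<And>x y. A x \<bullet> y = x \<bullet> A y"
  shows "finite {c. \<exists>v. v \<noteq> 0 \<and> A v = c *\<^sub>R v}" (is "finite ?E")
proof -
  define w where "w c = (SOME v. v \<noteq> 0 \<and> A v = c *\<^sub>R v)" for c
  have w: "w c \<noteq> 0 \<and> A (w c) = c *\<^sub>R w c" if "c \<in> ?E" for c
    unfolding w_def by (rule someI_ex) (use that in simp)
  have orth: "w c \<bullet> w d = 0" if "c \<in> ?E" "d \<in> ?E" "c \<noteq> d" for c d
    using sa[of "w c" "w d"] w[OF that(1)] w[OF that(2)] that(3) by simp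
  have "inj_on w ?E"
  proof (rule inj_onI, rule ccontr)
    fix c d assume cd: "c \<in> ?E" "d \<in> ?E" "w c = w d" "c \<noteq> d"
    have "w d \<bullet> w d = 0" using orth[OF cd(1,2,4)] cd(3) by simp
    thus False using w[OF cd(2)] by simp
  qed
  moreover have "independent (w ` ?E)"
  proof (rule pairwise_orthogonal_independent)
    show "pairwise orthogonal (w ` ?E)"
      unfolding pairwise_def orthogonal_def using orth by blast
    show "0 \<notin> w ` ?E" using w by force
  qed
  hence "finite (w ` ?E)" by (rule independent_imp_finite)
  ultimately show ?thesis by (rule finite_imageD[rotated])
qed

text \<open>
  With \<open>B = A - c\<close>, the function \<open>H z = z \<bullet> B z\<close> satisfies \<open>H' \<ge> 2 c H\<close> along solutions near
  \<open>p\<close>: for the linearized equation \<open>H' = 2 \<bar>B z\<bar>\<^sup>2 + 2 c H\<close>, and \<open>B\<close> is bounded below because \<open>c\<close>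
  is not an eigenvalue, so that the first term absorbs the nonlinear remainder.
\<close>

lemma self_adjoint_linearization_unstable:
  fixes F :: "'a::euclidean_space \<Rightarrow> 'a"
  assumes der: "(F has_derivative A) (at p)" and Fp: "F p = 0"
    and sa: "\<And>x y. A x \<bullet> y = x \<bullet> A y" and v: "v \<bullet> A v > 0"
  obtains e where "e > 0"
    and "\<And>d. d > 0 \<Longrightarrow> \<exists>x0. norm (x0 - p) < d \<and>
      (\<forall>x. x 0 = x0 \<longrightarrow> (\<forall>t\<ge>0. (x has_vector_derivative F (x t)) (at t within {0..})) \<longrightarrow>
        (\<exists>t\<ge>0. norm (x t - p) \<ge> e))"
proof -
  interpret A: bounded_linear A using der by (rule has_derivative_bounded_linear)
  have v0: "v \<noteq> 0" using v by auto
  \<comment> \<open>The interval between 0 and the Rayleigh quotient of \<open>v\<close> is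
    infinite, so it contains a non-eigenvalue \<open>c\<close>. Lying below the quotient makes
    \<open>H v\<close> positive later on.\<close>
  hence "infinite ({0<..<(v \<bullet> A v) / (v \<bullet> v)} - {c. \<exists>v. v \<noteq> 0 \<and> A v = c *\<^sub>R v})"
    using v self_adjoint_finite_eigenvalues[OF sa]
    by (intro Diff_infinite_finite) (auto simp: infinite_Ioo)
  then obtain c where "c \<in> {0<..<(v \<bullet> A v) / (v \<bullet> v)} - {c. \<exists>v. v \<noteq> 0 \<and> A v = c *\<^sub>R v}"
    using infinite_imp_nonempty by blast
  hence c: "c > 0" "c < (v \<bullet> A v) / (v \<bullet> v)" "\<And>v. A v = c *\<^sub>R v \<Longrightarrow> v = 0"
    by auto
  define B where "B z = A z - c *\<^sub>R z" for z
  have blB: "bounded_linear B" unfolding B_def by (intro bounded_linear_intros A.bounded_linear_axioms)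
  then interpret B: bounded_linear B .
  have saB: "B x \<bullet> y = x \<bullet> B y" for x y by (simp add: B_def inner_diff sa)
  have "inj B"
    using c(3) by (auto simp: linear_injective_0[OF B.linear_axioms] B_def)
  then obtain k where k: "k > 0" "\<And>z. k * norm z \<le> norm (B z)"
    using linear_inj_bounded_below_pos[of B] B.linear_axioms by blast
  \<comment> \<open>Taking the lower bound \<open>k\<close> of \<open>B\<close> as the tolerance
    makes the nonlinear remainder at most \<open>norm (B z)\<close> on the ball of radius
    \<open>e\<close>.\<close>
  obtain e where e: "e > 0" "\<And>y. norm (y - p) < e \<Longrightarrow> norm (F y - A (y - p)) \<le> k * norm (y - p)"
    using der k(1) unfolding has_derivative_at_alt Fp by auto
  obtain b where b: "b > 0" "\<And>z. norm (B z) \<le> norm z * b" using B.pos_bounded by blast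
  define H where "H z = z \<bullet> B z" for z
  have Hv: "H v > 0"
    using c(2) v0 by (simp add: H_def B_def inner_diff_right field_simps)
  have Hbd: "H z \<le> b * e^2" if "norm z < e" for z
  proof -
    have "H z \<le> norm z * norm (B z)" unfolding H_def by (rule norm_cauchy_schwarz)
    also have "\<dots> \<le> norm z * (norm z * b)" using b(2) by (intro mult_left_mono) auto
    also have "\<dots> = b * (norm z)^2" by (simp add: power2_eq_square)
    also have "\<dots> \<le> b * e^2" using that b(1) by (intro mult_left_mono power_mono) auto
    finally show ?thesis .
  qed
  show thesis
  proof (rule that[OF e(1)])
    fix d :: real assume d: "d > 0"
    define s where "s = d / (2 * norm v)"
    have s: "s > 0" using d v0 by (simp add: s_def)
    have "\<exists>t\<ge>0. norm (x t - p) \<ge> e"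
      if x0: "x 0 = p + s *\<^sub>R v"
        and sol: "\<forall>t\<ge>0. (x has_vector_derivative F (x t)) (at t within {0..})" for x
    proof (rule ccontr)
      assume "\<not> ?thesis"
      hence small: "norm (x t - p) < e" if "t \<ge> 0" for t using that by force
      define z where "z t = x t - p" for t
      \<comment> \<open>With this integrating factor, \<open>H' \<ge> 2 c H\<close> becomes the
        monotonicity of \<open>W\<close>.\<close>
      define W where "W t = exp (- (2 * c * t)) * H (z t)" for t
      define W' where "W' t = exp (- (2 * c * t)) *
          (z t \<bullet> B (F (x t)) + F (x t) \<bullet> B (z t) - 2 * c * H (z t))" for t
      have W': "(W has_real_derivative W' t) (at t within {0..})" if t: "t \<ge> 0" for t
      proof -
        have z: "(z has_vector_derivative F (x t)) (at t within {0..})"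
          unfolding z_def using sol t by (auto intro!: derivative_eq_intros)
        have Bz: "((\<lambda>t. B (z t)) has_vector_derivative B (F (x t))) (at t within {0..})"
          by (rule B.has_vector_derivative[OF z])
        have "((\<lambda>t. H (z t)) has_vector_derivative (z t \<bullet> B (F (x t)) + F (x t) \<bullet> B (z t)))
            (at t within {0..})"
          unfolding H_def
          by (rule bounded_bilinear.has_vector_derivative[OF bounded_bilinear_inner z Bz])
        hence "((\<lambda>t. H (z t)) has_real_derivative (z t \<bullet> B (F (x t)) + F (x t) \<bullet> B (z t)))
            (at t within {0..})"
          by (simp add: has_real_derivative_iff_has_vector_derivative)
        thus ?thesis unfolding W_def W'_def
          by (auto intro!: derivative_eq_intros simp: algebra_simps)
      qed
      have W'_nonneg: "W' t \<ge> 0" if t: "t \<ge> 0" for t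
      proof -
        define r where "r = F (x t) - A (z t)"
        have r: "norm r \<le> norm (B (z t))"
          using e(2)[OF small[OF t]] k(2)[of "z t"] by (simp add: r_def z_def)
        have "\<bar>B (z t) \<bullet> r\<bar> \<le> norm (B (z t)) * norm r" by (rule Cauchy_Schwarz_ineq2)
        also have "\<dots> \<le> norm (B (z t)) * norm (B (z t))" by (intro mult_left_mono r) auto
        also have "\<dots> = B (z t) \<bullet> B (z t)" by (simp add: dot_square_norm power2_eq_square)
        finally have "B (z t) \<bullet> B (z t) + B (z t) \<bullet> r \<ge> 0" by linarith
        moreover have "z t \<bullet> B (F (x t)) + F (x t) \<bullet> B (z t) - 2 * c * H (z t)
            = 2 * (B (z t) \<bullet> F (x t)) - 2 * c * (B (z t) \<bullet> z t)"
          using saB[of "z t" "F (x t)"] by (simp add: H_def inner_commute)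
        moreover have F: "F (x t) = B (z t) + c *\<^sub>R z t + r" by (simp add: r_def B_def)
        \<comment> \<open>Substituting \<open>F\<close> cancels the terms in \<open>c\<close>; what
          remains is nonnegative by Cauchy-Schwarz and the bound on \<open>r\<close>.\<close>
        have "2 * (B (z t) \<bullet> F (x t)) - 2 * c * (B (z t) \<bullet> z t)
            = 2 * (B (z t) \<bullet> B (z t) + B (z t) \<bullet> r)"
          unfolding F by (simp add: inner_add_right algebra_simps)
        ultimately show ?thesis unfolding W'_def by simp
      qed
      have grow: "H (z 0) * exp (2 * c * t) \<le> H (z t)" if t: "t \<ge> 0" for t
      proof -
        have "W 0 \<le> W t"
        proof (rule DERIV_nonneg_imp_increasing_open[OF t])
          fix u :: real assume u: "0 < u" "u < t"
          have "at u within {0..} = at u"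
            by (rule at_within_interior) (use u in simp)
          thus "\<exists>y. (W has_real_derivative y) (at u) \<and> y \<ge> 0"
            using W'[of u] W'_nonneg[of u] u by auto
        next
          have "continuous_on {0..} W"
            unfolding continuous_on_eq_continuous_within by (auto intro: DERIV_continuous[OF W'])
          thus "continuous_on {0..t} W" by (rule continuous_on_subset) auto
        qed
        hence "H (z 0) \<le> exp (- (2 * c * t)) * H (z t)" by (simp add: W_def)
        thus ?thesis by (simp add: exp_minus field_simps)
      qed
      have H0: "H (z 0) > 0"
        using Hv s by (simp add: z_def x0 H_def B.scaleR)
      \<comment> \<open>At this time the linear term of the exponential alone brings the lower bound
        for \<open>H\<close> up to its maximum \<open>b * e^2\<close> on the ball; the summand 1 in
        \<open>exp u \<ge> 1 + u\<close> exceeds it.\<close>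
      define t where "t = b * e^2 / H (z 0) / (2 * c)"
      have t: "t \<ge> 0" using H0 b(1) c(1) by (simp add: t_def)
      have "b * e^2 = H (z 0) * (2 * c * t)" using H0 c(1) by (simp add: t_def)
      also have "\<dots> < H (z 0) * exp (2 * c * t)"
        using exp_ge_add_one_self[of "2 * c * t"] H0 by (intro mult_strict_left_mono) linarith+
      also have "\<dots> \<le> H (z t)" by (rule grow[OF t])
      also have "\<dots> \<le> b * e^2" by (rule Hbd) (simp add: z_def small t)
      finally show False by simp
    qed
    moreover have "norm (p + s *\<^sub>R v - p) < d"
      using d v0 by (simp add: s_def)
    ultimately show "\<exists>x0. norm (x0 - p) < d \<and>
      (\<forall>x. x 0 = x0 \<longrightarrow> (\<forall>t\<ge>0. (x has_vector_derivative F (x t)) (at t within {0..})) \<longrightarrow>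
        (\<exists>t\<ge>0. norm (x t - p) \<ge> e))"
      by blast
  qed
qed

section \<open>Stability on the torus in terms of lifts\<close>

lemma circle_dist_le: "circle_dist a b \<le> \<bar>a - b\<bar>"
  unfolding circle_dist_def
  by (rule cINF_lower2[of _ _ 0]) (auto intro: bdd_belowI[of _ 0])

text \<open>A nonzero multiple of \<open>2 * pi\<close> moves a number of modulus at most
  \<open>pi\<close> to one of modulus at least \<open>pi\<close>, so \<open>k = 0\<close> attains
  the infimum.\<close>

lemma circle_dist_eq:
  assumes "\<bar>a - b\<bar> \<le> pi"
  shows "circle_dist a b = \<bar>a - b\<bar>"
proof (rule antisym[OF circle_dist_le])
  show "\<bar>a - b\<bar> \<le> circle_dist a b"
    unfolding circle_dist_def
  proof (rule cINF_greatest)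
    fix k :: int
    show "\<bar>a - b\<bar> \<le> \<bar>a - b + 2 * pi * of_int k\<bar>"
    proof (cases "k = 0")
      case False
      hence "1 \<le> \<bar>of_int k :: real\<bar>" by linarith
      hence "2 * pi * 1 \<le> 2 * pi * \<bar>of_int k\<bar>" by (intro mult_left_mono) auto
      hence "2 * pi \<le> \<bar>2 * pi * of_int k\<bar>" by (simp add: abs_mult)
      thus ?thesis using assms by linarith
    qed simp
  qed simp
qed

text \<open>A continuous lift cannot jump to another representative: to leave the interval it must
  pass a point at distance exactly \<open>e\<close> from \<open>a\<close>, and there the circle
  distance is also \<open>e\<close> because \<open>e \<le> pi\<close>.\<close>

lemma circle_dist_less_imp_lift_close:
  fixes g :: "real \<Rightarrow> real"
  assumes cont: "continuous_on {0..} g" and e: "e \<le> pi" and g0: "\<bar>g 0 - a\<bar> < e"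
    and close: "\<And>t. t \<ge> 0 \<Longrightarrow> circle_dist (g t) a < e" and t: "t \<ge> 0"
  shows "\<bar>g t - a\<bar> < e"
proof (rule ccontr)
  assume "\<not> ?thesis"
  hence "\<exists>s\<ge>0. s \<le> t \<and> \<bar>g s - a\<bar> = e"
    using g0 t by (intro IVT'[of "\<lambda>s. \<bar>g s - a\<bar>"])
      (auto intro!: continuous_intros continuous_on_subset[OF cont])
  then obtain s where s: "s \<ge> 0" "\<bar>g s - a\<bar> = e" by blast
  hence "circle_dist (g s) a = e" using e by (simp add: circle_dist_eq)
  thus False using close[OF s(1)] by simp
qed

lemma torus_stable_lift:
  fixes F :: "real ^ 'n::finite \<Rightarrow> real ^ 'n"
  assumes "torus_stable F \<phi>" and e: "e > 0"
  obtains d where "d > 0"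
    and "\<And>x t. forward_solution F x \<Longrightarrow> norm (x 0 - \<phi>) < d \<Longrightarrow> t \<ge> 0 \<Longrightarrow> norm (x t - \<phi>) < e"
proof -
  \<comment> \<open>The bound \<open>pi\<close> makes circle distance and lifted distance agree; the
    division by the dimension pays for the passage from coordinates to the norm through the sum of
    absolute values.\<close>
  define e' where "e' = min pi (e / CARD('n))"
  have e': "e' > 0" "e' \<le> pi" using e by (auto simp: e'_def)
  have "e' \<le> e / CARD('n)" by (simp add: e'_def)
  hence e'_card: "CARD('n) * e' \<le> e" by (simp add: pos_le_divide_eq mult.commute)
  obtain d where d: "d > 0" and stable: "\<forall>x. forward_solution F x \<and>
      (\<forall>i. circle_dist (x 0 $ i) (\<phi> $ i) < d) \<longrightarrow>
      (\<forall>t\<ge>0. \<forall>i. circle_dist (x t $ i) (\<phi> $ i) < e')"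
    using assms(1)[unfolded torus_stable_def, THEN spec, THEN mp, OF e'(1)] by (elim exE conjE)
  show thesis
  \<comment> \<open>Besides meeting the stability condition, the initial lift has to start within
    \<open>e'\<close> of \<open>\<phi>\<close> itself, not merely of a translate by multiples of
    \<open>2 * pi\<close>.\<close>
  proof (rule that[of "min d e'"])
    fix x and t :: real
    assume sol: "forward_solution F x" and x0: "norm (x 0 - \<phi>) < min d e'" and t: "t \<ge> 0"
    have x0': "\<bar>x 0 $ i - \<phi> $ i\<bar> < min d e'" for i
      using component_le_norm_cart[of "x 0 - \<phi>" i] x0 by simp
    have "continuous_on {0..} x"
      unfolding continuous_on_eq_continuous_within
      using sol has_vector_derivative_continuous by (fastforce simp: forward_solution_def)
    hence cont: "continuous_on {0..} (\<lambda>t. x t $ i)" for i by (intro continuous_intros)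
    have close: "circle_dist (x t $ i) (\<phi> $ i) < e'" if "t \<ge> 0" for t i
    proof -
      have "circle_dist (x 0 $ i) (\<phi> $ i) < d" for i
        using circle_dist_le[of "x 0 $ i" "\<phi> $ i"] x0'[of i] by linarith
      thus ?thesis using stable[THEN spec, of x] sol that by simp
    qed
    have "\<bar>(x t - \<phi>) $ i\<bar> < e'" for i
      using circle_dist_less_imp_lift_close[OF cont e'(2) _ close t] x0'[of i] by simp
    hence "(\<Sum>i\<in>UNIV. \<bar>(x t - \<phi>) $ i\<bar>) < (\<Sum>i\<in>(UNIV::'n set). e')"
      by (intro sum_strict_mono) auto
    thus "norm (x t - \<phi>) < e"
      using norm_le_l1_cart[of "x t - \<phi>"] e'_card by simp
  qed (use d e' in auto)
qed

section \<open>The coupling function and the vector field\<close>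

lemma periodic_continuous_bounded:
  fixes g :: "real \<Rightarrow> real"
  assumes per: "\<And>x. g (x + c) = g x" and c: "c > 0" and cont: "continuous_on UNIV g"
  obtains M where "\<And>x. \<bar>g x\<bar> \<le> M"
proof -
  interpret periodic_fun_simple g c by unfold_locales (rule per)
  have "compact (g ` {0..c})"
    by (intro compact_continuous_image continuous_on_subset[OF cont]) auto
  then obtain M where M: "\<And>y. y \<in> g ` {0..c} \<Longrightarrow> norm y \<le> M"
    using compact_imp_bounded bounded_iff by metis
  show thesis
  proof (rule that)
    fix x
    \<comment> \<open>Subtracting \<open>n\<close> periods moves \<open>x\<close> into the compact
      interval \<open>{0..c}\<close>.\<close>
    define n where "n = \<lfloor>x / c\<rfloor>"
    have "of_int n \<le> x / c" "x / c < of_int n + 1" by (auto simp: n_def)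
    hence "x - of_int n * c \<in> {0..c}" using c by (auto simp: field_simps)
    hence "\<bar>g (x - of_int n * c)\<bar> \<le> M" using M by force
    thus "\<bar>g x\<bar> \<le> M" by (simp add: minus_of_int)
  qed
qed

section \<open>Symmetries of the coupling function and its derivative\<close>

context
  fixes f :: "real \<Rightarrow> real"
  assumes f: "f \<in> F_half_pi"
begin

lemma F_half_pi_periodic: "f (x + 2 * pi) = f x" and F_half_pi_odd: "f (- x) = - f x"
  using f by (auto simp: F_half_pi_def)

lemma F_half_pi_0: "f 0 = 0"
  using F_half_pi_odd[of 0] by simp

lemma F_half_pi_has_derivative: "(f has_real_derivative deriv f x) (at x)"
  and F_half_pi_continuous_deriv: "continuous_on UNIV (deriv f)"
proof -
  obtain D where D: "\<And>x. (f has_real_derivative D x) (at x)" "continuous_on UNIV D"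
    using f unfolding F_half_pi_def C1_differentiable_on_def
    by (auto simp: has_real_derivative_iff_has_vector_derivative)
  have "deriv f = D" using D(1) by (auto intro: DERIV_imp_deriv)
  thus "(f has_real_derivative deriv f x) (at x)" "continuous_on UNIV (deriv f)"
    using D by auto
qed

lemma F_half_pi_deriv_even: "deriv f (- x) = deriv f x"
proof -
  have "((\<lambda>x. - f (- x)) has_real_derivative deriv f (- x)) (at x)"
    by (rule derivative_eq_intros DERIV_chain'[OF _ F_half_pi_has_derivative] refl)+ simp
  thus ?thesis by (simp add: F_half_pi_odd DERIV_imp_deriv)
qed

lemma F_half_pi_deriv_periodic: "deriv f (x + 2 * pi) = deriv f x"
proof -
  have "((\<lambda>x. f (x + 2 * pi)) has_real_derivative deriv f (x + 2 * pi)) (at x)"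
    using F_half_pi_has_derivative[of "x + 2 * pi"] by (simp add: DERIV_shift)
  thus ?thesis by (simp add: F_half_pi_periodic DERIV_imp_deriv)
qed

text \<open>Reflection in \<open>pi / 2\<close> sends \<open>x + pi\<close> to \<open>- x\<close>,
  so evenness there and oddness give \<open>f (x + pi) = - f x\<close>, which is then
  differentiated.\<close>

lemma F_half_pi_deriv_antiperiodic:
  assumes ev: "even_around_half_pi f"
  shows "deriv f (x + pi) = - deriv f x"
proof -
  have "f (x + pi) = - f x" for x
    using ev[unfolded even_around_half_pi_def, rule_format, of "pi / 2 + x"] F_half_pi_odd[of x]
    by (simp add: algebra_simps)
  moreover have "((\<lambda>x. - f (x + pi)) has_real_derivative - deriv f (x + pi)) (at x)"
    using F_half_pi_has_derivative[of "x + pi"] by (intro DERIV_minus) (simp add: DERIV_shift)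
  ultimately have "deriv f x = - deriv f (x + pi)" by (simp add: DERIV_imp_deriv)
  thus ?thesis by simp
qed

text \<open>The sign conditions on the derivative cover only open intervals that omit 0, so the sign
  is carried over from the interior point \<open>pi\<close>.\<close>

lemma F_half_pi_deriv_0_pos:
  assumes "even_around_half_pi f"
  shows "deriv f 0 > 0"
proof -
  have "pi \<in> {pi / 2<..<3 * pi / 2}" by simp
  hence "deriv f pi < 0" using f unfolding F_half_pi_def by blast
  thus ?thesis using F_half_pi_deriv_antiperiodic[OF assms, of 0] by simp
qed

section \<open>Linearization and global bounds of the vector field\<close>

lemma complete_graph_field_nth:
  "complete_graph_field f \<epsilon> \<phi> $ i = \<epsilon> * (\<Sum>j\<in>UNIV. f (\<phi> $ j - \<phi> $ i))"
  \<comment> \<open>The added summand \<open>j = i\<close> is \<open>f 0 = 0\<close>. Summing over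
    all oscillators makes the index set independent of \<open>i\<close>, which the later reindexing
    uses.\<close>
  by (simp add: complete_graph_field_def sum.remove[of UNIV i] F_half_pi_0)

lemma complete_graph_field_has_derivative:
  fixes \<phi> :: "real ^ 'n::finite"
  shows "(complete_graph_field f \<epsilon> has_derivative
    (\<lambda>v. \<chi> i. \<epsilon> * (\<Sum>j\<in>UNIV. deriv f (\<phi> $ j - \<phi> $ i) * (v $ j - v $ i)))) (at \<phi>)"
proof (subst has_derivative_componentwise_within, rule ballI)
  fix b :: "real ^ 'n" assume "b \<in> Basis"
  then obtain i where b: "b = axis i 1" by (auto simp: Basis_vec_def)
  have "((\<lambda>x. f (x $ j - x $ i)) has_derivative
      (\<lambda>v. deriv f (\<phi> $ j - \<phi> $ i) * (v $ j - v $ i))) (at \<phi>)" for j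
  proof -
    have "((\<lambda>x. x $ j - x $ i) has_derivative (\<lambda>v. v $ j - v $ i)) (at \<phi>)"
      by (intro has_derivative_diff bounded_linear_imp_has_derivative bounded_linear_vec_nth)
    thus ?thesis
      by (rule has_derivative_compose)
         (use F_half_pi_has_derivative in \<open>simp add: has_field_derivative_def\<close>)
  qed
  hence "((\<lambda>x. \<epsilon> * (\<Sum>j\<in>UNIV. f (x $ j - x $ i))) has_derivative
      (\<lambda>v. \<epsilon> * (\<Sum>j\<in>UNIV. deriv f (\<phi> $ j - \<phi> $ i) * (v $ j - v $ i)))) (at \<phi>)"
    by (intro has_derivative_mult_right has_derivative_sum)
  thus "((\<lambda>x. complete_graph_field f \<epsilon> x \<bullet> b) has_derivative
      (\<lambda>v. (\<chi> i. \<epsilon> * (\<Sum>j\<in>UNIV. deriv f (\<phi> $ j - \<phi> $ i) * (v $ j - v $ i))) \<bullet> b)) (at \<phi>)"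
    by (simp add: b inner_axis complete_graph_field_nth)
qed

lemma complete_graph_field_lipschitz:
  obtains L where "L-lipschitz_on UNIV (complete_graph_field f \<epsilon> :: real ^ 'n::finite \<Rightarrow> real ^ 'n)"
proof -
  obtain K where K: "\<And>x. \<bar>deriv f x\<bar> \<le> K"
    using periodic_continuous_bounded[of "deriv f" "2 * pi"] F_half_pi_deriv_periodic
      F_half_pi_continuous_deriv by auto
  have K0: "K \<ge> 0" using K[of 0] by linarith
  have lipf: "\<bar>f a - f b\<bar> \<le> K * \<bar>a - b\<bar>" for a b
    using field_differentiable_bound[of UNIV f "deriv f" K a b] F_half_pi_has_derivative K by auto
  \<comment> \<open>The outer dimension factor comes from bounding the norm by the sum of
    coordinates, the inner one from the sum over \<open>j\<close>, and the 2 from the difference of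
    two phases in each argument.\<close>
  define L where "L = CARD('n) * (\<bar>\<epsilon>\<bar> * (CARD('n) * (K * 2)))"
  have "norm (complete_graph_field f \<epsilon> x - complete_graph_field f \<epsilon> y) \<le> L * norm (x - y)"
    for x y :: "real ^ 'n"
  proof -
    have comp: "\<bar>(complete_graph_field f \<epsilon> x - complete_graph_field f \<epsilon> y) $ i\<bar>
        \<le> \<bar>\<epsilon>\<bar> * (CARD('n) * (K * 2)) * norm (x - y)" for i
    proof -
      have "\<bar>f (x $ j - x $ i) - f (y $ j - y $ i)\<bar> \<le> K * (2 * norm (x - y))" for j
      proof (rule order_trans[OF lipf], intro mult_left_mono K0)
        show "\<bar>x $ j - x $ i - (y $ j - y $ i)\<bar> \<le> 2 * norm (x - y)"
          using component_le_norm_cart[of "x - y" i] component_le_norm_cart[of "x - y" j] by simp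
      qed
      hence "\<bar>\<Sum>j\<in>UNIV. f (x $ j - x $ i) - f (y $ j - y $ i)\<bar>
          \<le> (\<Sum>j\<in>(UNIV::'n set). K * (2 * norm (x - y)))"
        by (intro order_trans[OF sum_abs] sum_mono)
      hence "\<bar>\<epsilon>\<bar> * \<bar>\<Sum>j\<in>UNIV. f (x $ j - x $ i) - f (y $ j - y $ i)\<bar>
          \<le> \<bar>\<epsilon>\<bar> * (CARD('n) * (K * (2 * norm (x - y))))"
        by (intro mult_left_mono) auto
      thus ?thesis
        by (simp add: complete_graph_field_nth sum_subtractf abs_mult mult_ac
            flip: right_diff_distrib)
    qed
    have "norm (complete_graph_field f \<epsilon> x - complete_graph_field f \<epsilon> y)
        \<le> (\<Sum>i\<in>(UNIV::'n set). \<bar>\<epsilon>\<bar> * (CARD('n) * (K * 2)) * norm (x - y))"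
      by (rule order_trans[OF norm_le_l1_cart sum_mono[OF comp]])
    thus ?thesis by (simp add: L_def mult_ac)
  qed
  moreover have "L \<ge> 0" by (simp add: L_def K0)
  ultimately show thesis by (intro that[of L] lipschitz_onI) (auto simp: dist_norm)
qed

lemma complete_graph_field_bounded:
  obtains M where "\<And>x :: real ^ 'n::finite. norm (complete_graph_field f \<epsilon> x) \<le> M"
proof -
  have "continuous_on UNIV f"
    using F_half_pi_has_derivative DERIV_continuous continuous_at_imp_continuous_on by blast
  then obtain K where K: "\<And>x. \<bar>f x\<bar> \<le> K"
    using periodic_continuous_bounded[of f "2 * pi"] F_half_pi_periodic by auto
  have comp: "\<bar>complete_graph_field f \<epsilon> x $ i\<bar> \<le> \<bar>\<epsilon>\<bar> * (\<Sum>j\<in>(UNIV::'n set). K)"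
    for x :: "real ^ 'n" and i
    unfolding complete_graph_field_nth abs_mult
    by (intro mult_left_mono order_trans[OF sum_abs] sum_mono K) auto
  show thesis
    by (rule that[of "\<Sum>i\<in>(UNIV::'n set). \<bar>\<epsilon>\<bar> * (\<Sum>j\<in>(UNIV::'n set). K)"])
       (rule order_trans[OF norm_le_l1_cart sum_mono[OF comp]])
qed

text \<open>Stability speaks only about solutions that exist, so refuting it takes an actual
  solution through each escaping initial point.\<close>

lemma complete_graph_field_forward_solution:
  fixes x0 :: "real ^ 'n::finite"
  obtains x where "x 0 = x0" "forward_solution (complete_graph_field f \<epsilon>) x"
proof -
  obtain L where L: "L-lipschitz_on UNIV (complete_graph_field f \<epsilon> :: real ^ 'n \<Rightarrow> real ^ 'n)"
    using complete_graph_field_lipschitz by blast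
  obtain M where M: "norm (complete_graph_field f \<epsilon> x) \<le> M" for x :: "real ^ 'n"
    using complete_graph_field_bounded by blast
  obtain x where "x 0 = x0" "\<And>t. t \<ge> 0 \<Longrightarrow>
      (x has_vector_derivative complete_graph_field f \<epsilon> (x t)) (at t within {0..})"
    using bounded_lipschitz_global_solution[OF L M] by blast
  thus thesis by (intro that[of x]) (simp_all add: forward_solution_def)
qed

end

section \<open>Equilibria invariant under the half turn\<close>

text \<open>For even \<open>m\<close> the power \<open>m div 2\<close> of the generator of the
  cyclic factor rotates by exactly \<open>pi\<close>. The map obtained is the inverse of its
  permutation, since the action reads phases through the inverse.\<close>

lemma isotropy_half_turn:
  fixes \<phi> :: "real ^ 'n::finite"
  assumes iso: "isotropy \<phi> \<in> block_cyclic_subgroups ks m" and m: "m > 0" "even m"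
  obtains \<sigma> where "bij \<sigma>" and "\<And>i. [\<phi> $ (\<sigma> i) + pi = \<phi> $ i] (rmod (2 * pi))"
proof -
  obtain B \<tau> where iso_eq: "isotropy \<phi> = block_cyclic_group B \<tau> m"
    using iso by (auto simp: block_cyclic_subgroups_def)
  define \<rho> where "\<rho> = \<tau> ^^ (m div 2)"
  have "(\<rho> \<circ> id, 2 * pi * real (m div 2) / real m) \<in> block_cyclic_group B \<tau> m"
    unfolding block_cyclic_group_def \<rho>_def using m permutes_id by fastforce
  moreover have "2 * pi * real (m div 2) / real m = pi"
    using m by (auto elim!: evenE)
  ultimately have mem: "(\<rho>, pi) \<in> isotropy \<phi>" by (simp add: iso_eq)
  hence "\<rho> permutes UNIV" by (simp add: isotropy_def symmetries_def)
  hence "bij (inv \<rho>)" using permutes_inv permutes_bij by blast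
  moreover have "[\<phi> $ (inv \<rho> i) + pi = \<phi> $ i] (rmod (2 * pi))" for i
    using mem by (simp add: isotropy_def torus_eq_def symmetry_act_def)
  ultimately show thesis by (rule that)
qed

text \<open>Passing from each oscillator to its antipodal partner permutes the summands and flips
  their signs, so the sum equals its own negative.\<close>

lemma sum_deriv_half_turn:
  fixes \<phi> :: "real ^ 'n::finite"
  assumes f: "f \<in> F_half_pi" and ev: "even_around_half_pi f"
    and \<sigma>: "bij \<sigma>" "\<And>i. [\<phi> $ (\<sigma> i) + pi = \<phi> $ i] (rmod (2 * pi))"
  shows "(\<Sum>j\<in>UNIV. deriv f (\<phi> $ j - z)) = 0"
proof -
  interpret periodic_fun_simple "deriv f" "2 * pi"
    by unfold_locales (rule F_half_pi_deriv_periodic[OF f])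
  have "deriv f (\<phi> $ j - z) = - deriv f (\<phi> $ \<sigma> j - z)" for j
  proof -
    obtain n where "\<phi> $ j = \<phi> $ (\<sigma> j) + pi + of_int n * (2 * pi)"
      using \<sigma>(2)[of j] by (auto simp: rcong_altdef)
    hence "\<phi> $ j - z = (\<phi> $ \<sigma> j - z + pi) + of_int n * (2 * pi)" by simp
    hence "deriv f (\<phi> $ j - z) = deriv f (\<phi> $ \<sigma> j - z + pi)" by (simp only: plus_of_int)
    thus ?thesis by (simp add: F_half_pi_deriv_antiperiodic[OF f ev])
  qed
  hence "(\<Sum>j\<in>UNIV. deriv f (\<phi> $ j - z)) = - (\<Sum>j\<in>UNIV. deriv f (\<phi> $ \<sigma> j - z))"
    unfolding sum_negf[symmetric] by (rule sum.cong[OF refl])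
  also have "(\<Sum>j\<in>UNIV. deriv f (\<phi> $ \<sigma> j - z)) = (\<Sum>j\<in>UNIV. deriv f (\<phi> $ j - z))"
    using sum.reindex_bij_betw[OF \<sigma>(1), of "\<lambda>j. deriv f (\<phi> $ j - z)"] by simp
  finally show ?thesis by simp
qed

section \<open>Escape from the equilibrium contradicts stability\<close>

theorem proposition2:
  fixes f :: "real \<Rightarrow> real" and \<epsilon> :: real and \<phi> :: "real ^ 'n::finite"
    and ks :: "nat list" and m :: nat
  assumes "f \<in> F_half_pi" and "even_around_half_pi f" and "\<epsilon> > 0"
    and "equilibrium (complete_graph_field f \<epsilon>) \<phi>"
    and "\<forall>k \<in> set ks. k > 0" and "m > 0" and "sum_list ks * m = CARD('n)"
    and "isotropy \<phi> \<in> block_cyclic_subgroups ks m"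
    and "even m"
  shows "torus_unstable (complete_graph_field f \<epsilon>) \<phi>"
  unfolding torus_unstable_def
proof
  assume stable: "torus_stable (complete_graph_field f \<epsilon>) \<phi>"
  obtain \<sigma> where \<sigma>: "bij \<sigma>" "\<And>i. [\<phi> $ (\<sigma> i) + pi = \<phi> $ i] (rmod (2 * pi))"
    using isotropy_half_turn assms(6,8,9) by blast
  define A :: "real ^ 'n \<Rightarrow> real ^ 'n"
    where "A v = (\<chi> i. \<epsilon> * (\<Sum>j\<in>UNIV. deriv f (\<phi> $ j - \<phi> $ i) * v $ j))" for v
  \<comment> \<open>The part multiplying \<open>v $ i\<close> is the vanishing sum over antipodal
    pairs, so the Jacobian loses its usual row-sum correction on the diagonal.\<close>
  have "(\<Sum>j\<in>UNIV. deriv f (\<phi> $ j - \<phi> $ i) * (v $ j - v $ i))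
      = (\<Sum>j\<in>UNIV. deriv f (\<phi> $ j - \<phi> $ i) * v $ j)" for v i
    using sum_deriv_half_turn[OF assms(1,2) \<sigma>, of "\<phi> $ i"]
    by (simp add: right_diff_distrib sum_subtractf flip: sum_distrib_right)
  hence der: "(complete_graph_field f \<epsilon> has_derivative A) (at \<phi>)"
    using complete_graph_field_has_derivative[OF assms(1), of \<epsilon> \<phi>] unfolding A_def by simp
  have sa: "A x \<bullet> y = x \<bullet> A y" for x y
  proof -
    define a where "a i j = \<epsilon> * deriv f (\<phi> $ j - \<phi> $ i)" for i j
    \<comment> \<open>An odd \<open>f\<close> has an even derivative, so exchanging the two
      oscillators leaves the entry unchanged.\<close>
    have sym: "a i j = a j i" for i j
      unfolding a_def by (metis F_half_pi_deriv_even[OF assms(1)] minus_diff_eq)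
    have A: "A v $ i = (\<Sum>j\<in>UNIV. a i j * v $ j)" for v i
      by (simp add: A_def a_def sum_distrib_left mult.assoc)
    have "A x \<bullet> y = (\<Sum>i\<in>UNIV. \<Sum>j\<in>UNIV. a i j * x $ j * y $ i)"
      by (simp only: inner_vec_def A sum_distrib_right inner_real_def)
    also have "\<dots> = (\<Sum>j\<in>UNIV. \<Sum>i\<in>UNIV. a i j * x $ j * y $ i)"
      by (rule sum.swap)
    also have "\<dots> = (\<Sum>j\<in>UNIV. \<Sum>i\<in>UNIV. x $ j * (a j i * y $ i))"
      by (intro sum.cong refl) (metis sym mult.assoc mult.commute)
    also have "\<dots> = x \<bullet> A y"
      by (simp only: inner_vec_def A sum_distrib_left inner_real_def)
    finally show ?thesis .
  qed
  \<comment> \<open>Any coordinate vector serves as the positive direction: its quadratic form is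
    the diagonal entry \<open>\<epsilon> * deriv f 0\<close>.\<close>
  fix i :: 'n
  have "A (axis i 1) $ i = \<epsilon> * deriv f 0"
    by (simp add: A_def axis_def if_distrib[of "\<lambda>x. _ * x"] cong: if_cong)
  hence pos: "axis i 1 \<bullet> A (axis i 1) > 0"
    using F_half_pi_deriv_0_pos[OF assms(1,2)] assms(3) by (simp add: inner_axis')
  let ?F = "complete_graph_field f \<epsilon> :: real ^ 'n \<Rightarrow> real ^ 'n"
  have F0: "?F \<phi> = 0" using assms(4) by (simp add: equilibrium_def)
  obtain e where e: "e > 0" and escape: "\<And>d. d > 0 \<Longrightarrow> \<exists>x0. norm (x0 - \<phi>) < d \<and>
      (\<forall>x. x 0 = x0 \<longrightarrow>
        (\<forall>t\<ge>0. (x has_vector_derivative ?F (x t)) (at t within {0..})) \<longrightarrow>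
        (\<exists>t\<ge>0. norm (x t - \<phi>) \<ge> e))"
    by (rule self_adjoint_linearization_unstable[OF der F0 sa pos]) rule
  obtain d where d: "d > 0" and stay: "\<And>x t. forward_solution ?F x \<Longrightarrow>
      norm (x 0 - \<phi>) < d \<Longrightarrow> t \<ge> 0 \<Longrightarrow> norm (x t - \<phi>) < e"
    using torus_stable_lift[OF stable e] by blast
  obtain x0 where x0: "norm (x0 - \<phi>) < d"
    and leave: "\<And>x. x 0 = x0 \<Longrightarrow> forward_solution ?F x \<Longrightarrow> \<exists>t\<ge>0. norm (x t - \<phi>) \<ge> e"
    using escape[OF d] unfolding forward_solution_def by blast
  obtain x where x: "x 0 = x0" "forward_solution ?F x"
    by (rule complete_graph_field_forward_solution[OF assms(1)])
  obtain t where "t \<ge> 0" "norm (x t - \<phi>) \<ge> e" using leave[OF x] by blast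
  thus False using stay[OF x(2), of t] x0 x(1) by simp
qed

end
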